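(* Let $C$ be a conjugation on a Hilbert space $\mathcal H$ and let $V\in\mathbf B(\mathcal H_V,\mathcal H)$ be a bounded $C$-symmetric operator defined on a closed subspace $\operatorname{dom}V=\mathcal H_V$ of $\mathcal H$. Let $Z_0\in\mathbf B(C\mathcal H_V,\mathcal H_V^\perp)$ be the operator $Z_0:Ch\mapsto P_{\mathcal H_V^\perp}CVh$, $h\in\mathcal H_V$. For $\widetilde Z\in\mathbf B(\mathcal H,\mathcal H_V^\perp)$ put $$\widetilde{\mathcal V}_{\widetilde Z}:=VP_{\mathcal H_V}+\widetilde Z^*P_{\mathcal H_V^\perp},\qquad \widetilde T_{\widetilde Z}:=\tfrac12\left(\widetilde{\mathcal V}_{\widetilde Z}+C\widetilde{\mathcal V}_{\widetilde Z}^*C\right).$$ Then: (1) Each bounded $C$-self-adjoint extension $\widetilde T$ of $V$ on $\mathcal H$ has the form $\widetilde T=\widetilde T_{\widetilde Z}$, where $\widetilde Z\in\mathbf B(\mathcal H,\mathcal H_V^\perp)$ is an extension of $Z_0$ to $\mathcal H$. Conversely, for each extension $\widetilde Z\in\mathbf B(\mathcal H,\mathcal H_V^\perp)$ of $Z_0$, the operator $\widetilde T_{\widetilde Z}$ is a bounded $C$-self-adjoint extension of $V$. (2) With $\widetilde Z_0:=Z_0P_{C\mathcal H_V}$ the equalities $$VP_{\mathcal H_V}+CV^*CP_{\mathcal H_V^\perp}=\widetilde T_{\widetilde Z_0}=\tfrac12\left(\widetilde{\mathcal V}_{\widetilde Z_0}+C\widetilde{\mathcal V}_{\widetilde Z_0}^*C\right)$$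 hold. (3) If $\widetilde Z=Z_0P_{C\mathcal H_V}+\widetilde YP_{C\mathcal H_V^\perp}$, where $\widetilde Y\in\mathbf B(C\mathcal H_V^\perp,\mathcal H_V^\perp)$, then $$\widetilde T_{\widetilde Z}=\widetilde T_{\widetilde Z_0}+\tfrac12\left(\widetilde Y^*+C\widetilde YC\right)P_{\mathcal H_V^\perp}.$$
   Context: $\mathbf B(\mathcal H_1,\mathcal H_2)$ denotes the bounded linear operators from $\mathcal H_1$ to $\mathcal H_2$. A conjugation on $\mathcal H$ is an anti-linear isometric operator $C$ on $\mathcal H$ with $C^2=I$. $V$ is $C$-symmetric if $(Vf,Cg)=(f,CVg)$ for all $f,g\in\mathcal H_V$. A bounded operator $B$ on $\mathcal H$ is $C$-self-adjoint if $B=CB^*C$. $\mathcal H_V^\perp:=\mathcal H\ominus\mathcal H_V$, $P_{\mathfrak M}$ is the orthogonal projection onto a closed subspace $\mathfrak M$, and $V^*\in\mathbf B(\mathcal H,\mathcal H_V)$ is the adjoint of $V\in\mathbf B(\mathcal H_V,\mathcal H)$. The adjoint $\widetilde Z^*$ acts from $\mathcal H_V^\perp$ to $\mathcal H$, and $\widetilde Y^*$ acts from $\mathcal H_V^\perp$ to $C\mathcal H_V^\perp$. *)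

theory Defs
  imports "HOL-Analysis.Analysis"
begin

text \<open>Complex Hilbert spaces. The inner product is linear in the first argument and conjugate
  linear in the second.\<close>

class complex_hilbert = real_normed_vector + complete_space +
  fixes scaleC :: "complex \<Rightarrow> 'a \<Rightarrow> 'a" (infixr "*\<^sub>C" 75)
    and cinner :: "'a \<Rightarrow> 'a \<Rightarrow> complex"
  assumes scaleC_add_right: "c *\<^sub>C (x + y) = c *\<^sub>C x + c *\<^sub>C y"
    and scaleC_add_left: "(c + d) *\<^sub>C x = c *\<^sub>C x + d *\<^sub>C x"
    and scaleC_scaleC: "c *\<^sub>C d *\<^sub>C x = (c * d) *\<^sub>C x"
    and scaleR_scaleC: "r *\<^sub>R x = complex_of_real r *\<^sub>C x"
    and cinner_commute: "cinner x y = cnj (cinner y x)"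
    and cinner_add_left: "cinner (x + y) z = cinner x z + cinner y z"
    and cinner_scaleC_left: "cinner (c *\<^sub>C x) y = c * cinner x y"
    and cinner_self: "cinner x x = complex_of_real ((norm x)\<^sup>2)"

definition closed_csubspace :: "'a::complex_hilbert set \<Rightarrow> bool" where
  "closed_csubspace M \<longleftrightarrow> closed M \<and> 0 \<in> M \<and> (\<forall>x\<in>M. \<forall>y\<in>M. x + y \<in> M) \<and> (\<forall>c. \<forall>x\<in>M. c *\<^sub>C x \<in> M)"

definition ocompl :: "'a::complex_hilbert set \<Rightarrow> 'a set" where
  "ocompl M = {x. \<forall>m\<in>M. cinner x m = 0}"

definition oproj :: "'a::complex_hilbert set \<Rightarrow> 'a \<Rightarrow> 'a" where
  "oproj M x = (THE p. p \<in> M \<and> x - p \<in> ocompl M)"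

text \<open>Operators between closed subspaces are functions on the ambient space; only their values on
  the domain \<open>M\<close> matter.\<close>

definition bounded_ops :: "'a::complex_hilbert set \<Rightarrow> 'a set \<Rightarrow> ('a \<Rightarrow> 'a) set" where
  "bounded_ops M N = {T. (\<forall>x\<in>M. T x \<in> N) \<and>
     (\<forall>x\<in>M. \<forall>y\<in>M. T (x + y) = T x + T y) \<and>
     (\<forall>c. \<forall>x\<in>M. T (c *\<^sub>C x) = c *\<^sub>C T x) \<and>
     (\<exists>K. \<forall>x\<in>M. norm (T x) \<le> K * norm x)}"

text \<open>For \<open>T \<in> bounded_ops M N\<close>, the function \<open>cadjoint M T\<close> restricted to \<open>N\<close> is the adjoint
  operator from \<open>N\<close> to \<open>M\<close>.\<close>

definition cadjoint :: "'a::complex_hilbert set \<Rightarrow> ('a \<Rightarrow> 'a) \<Rightarrow> 'a \<Rightarrow> 'a" where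
  "cadjoint M T g = (THE h. h \<in> M \<and> (\<forall>f\<in>M. cinner (T f) g = cinner f h))"

definition conjugation :: "('a::complex_hilbert \<Rightarrow> 'a) \<Rightarrow> bool" where
  "conjugation C \<longleftrightarrow>
     (\<forall>x y. C (x + y) = C x + C y) \<and>
     (\<forall>c x. C (c *\<^sub>C x) = cnj c *\<^sub>C C x) \<and>
     (\<forall>x. norm (C x) = norm x) \<and>
     (\<forall>x. C (C x) = x)"

definition c_symmetric_on ::
    "('a::complex_hilbert \<Rightarrow> 'a) \<Rightarrow> 'a set \<Rightarrow> ('a \<Rightarrow> 'a) \<Rightarrow> bool" where
  "c_symmetric_on C M V \<longleftrightarrow> (\<forall>f\<in>M. \<forall>g\<in>M. cinner (V f) (C g) = cinner f (C (V g)))"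

definition c_selfadjoint :: "('a::complex_hilbert \<Rightarrow> 'a) \<Rightarrow> ('a \<Rightarrow> 'a) \<Rightarrow> bool" where
  "c_selfadjoint C B \<longleftrightarrow> B \<in> bounded_ops UNIV UNIV \<and> (\<forall>x. B x = C (cadjoint UNIV B (C x)))"

definition extends_on :: "'a set \<Rightarrow> ('a \<Rightarrow> 'b) \<Rightarrow> ('a \<Rightarrow> 'b) \<Rightarrow> bool" where
  "extends_on M S T \<longleftrightarrow> (\<forall>x\<in>M. T x = S x)"

definition V_ext ::
    "'a::complex_hilbert set \<Rightarrow> ('a \<Rightarrow> 'a) \<Rightarrow> ('a \<Rightarrow> 'a) \<Rightarrow> 'a \<Rightarrow> 'a" where
  "V_ext M V Z x = V (oproj M x) + cadjoint UNIV Z (oproj (ocompl M) x)"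

definition T_ext ::
    "('a::complex_hilbert \<Rightarrow> 'a) \<Rightarrow> 'a set \<Rightarrow> ('a \<Rightarrow> 'a) \<Rightarrow> ('a \<Rightarrow> 'a) \<Rightarrow> 'a \<Rightarrow> 'a" where
  "T_ext C M V Z x =
     (1/2) *\<^sub>C (V_ext M V Z x + C (cadjoint UNIV (V_ext M V Z) (C x)))"

end

theory Submission
  imports Defs
begin

text \<open>The key observation is that the adjoint of \<open>W = V P + Z\<^sup>* (I - P)\<close>, with \<open>P\<close> the projection
  onto the domain \<open>M\<close> of \<open>V\<close>, is \<open>V\<^sup>* + Z\<close> (\<open>cadjoint_V_ext\<close>).

  Since \<open>C\<close>-symmetry amounts to \<open>V\<^sup>* C h = P C V h\<close> on \<open>M\<close> (\<open>cadjoint_c_symmetric\<close>), and \<open>Z\<close>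
  extends \<open>Z\<^sub>0\<close> exactly when \<open>Z C h = (I - P) C V h\<close>, the two halves add up: \<open>W\<^sup>* C h = C V h\<close>, so
  \<open>C W\<^sup>* C\<close> extends \<open>V\<close> just as \<open>W\<close> does. Their average therefore extends \<open>V\<close>, and it is
  \<open>C\<close>-self-adjoint for any bounded \<open>W\<close> (\<open>c_selfadjoint_average\<close>). Conversely, a
  \<open>C\<close>-self-adjoint extension \<open>T\<close> is recovered from \<open>Z = (I - P) T\<^sup>*\<close>: then \<open>Z\<^sup>*\<close> is \<open>T\<close>
  restricted to the complement of \<open>M\<close>, hence \<open>W = T\<close>, and averaging \<open>T\<close> with \<open>C T\<^sup>* C = T\<close>
  changes nothing. The remaining formulas follow by computing \<open>Z\<^sup>*\<close> for the
  given \<open>Z\<close> and using that \<open>C\<close> intertwines the projections onto \<open>M\<close> and \<open>C M\<close>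
  (\<open>oproj_conj\<close>).

  Both the existence of projections and that of adjoints come from one representation theorem
  for bounded functionals on a closed subspace (\<open>Riesz_representation\<close>).\<close>

section \<open>Elementary facts on the inner product\<close>

lemma scaleC_one [simp]: "1 *\<^sub>C x = (x::'a::complex_hilbert)"
  using scaleR_scaleC[of 1 x] by simp

lemma scaleC_zero_right [simp]: "c *\<^sub>C (0::'a::complex_hilbert) = 0"
  using scaleC_add_right[of c 0 "0::'a"] by simp

lemma scaleC_minus_right [simp]: "c *\<^sub>C (- x) = - (c *\<^sub>C (x::'a::complex_hilbert))"
  using scaleC_add_right[of c x "- x"] by (simp add: eq_neg_iff_add_eq_0 add.commute)

lemma scaleC_minus_one: "(- 1) *\<^sub>C x = - (x::'a::complex_hilbert)"
  using scaleR_scaleC[of "- 1" x] by simp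

lemma half_scaleC_double: "(1/2) *\<^sub>C (x + x) = (x::'a::complex_hilbert)"
  by (simp add: scaleC_add_right scaleC_add_left[symmetric])

lemma cinner_add_right: "cinner x (y + z) = cinner x y + cinner x (z::'a::complex_hilbert)"
  by (metis cinner_add_left cinner_commute complex_cnj_add)

lemma cinner_scaleC_right: "cinner x (c *\<^sub>C y) = cnj c * cinner x (y::'a::complex_hilbert)"
  by (metis cinner_commute cinner_scaleC_left complex_cnj_mult)

lemma cinner_minus_left: "cinner (- x) y = - cinner x (y::'a::complex_hilbert)"
  using cinner_scaleC_left[of "- 1" x y] by (simp add: scaleC_minus_one)

lemma cinner_minus_right: "cinner x (- y) = - cinner x (y::'a::complex_hilbert)"
  using cinner_scaleC_right[of x "- 1" y] by (simp add: scaleC_minus_one)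

lemma cinner_diff_left: "cinner (x - y) z = cinner x z - cinner y (z::'a::complex_hilbert)"
  using cinner_add_left[of x "- y" z] by (simp add: cinner_minus_left)

lemma cinner_diff_right: "cinner x (y - z) = cinner x y - cinner x (z::'a::complex_hilbert)"
  using cinner_add_right[of x y "- z"] by (simp add: cinner_minus_right)

lemma cinner_zero_left [simp]: "cinner 0 (x::'a::complex_hilbert) = 0"
  using cinner_add_left[of 0 0 x] by simp

lemma cinner_zero_right [simp]: "cinner (x::'a::complex_hilbert) 0 = 0"
  using cinner_add_right[of x 0 0] by simp

lemma cinner_self_eq_zero: "cinner x x = 0 \<longleftrightarrow> x = (0::'a::complex_hilbert)"
  by (simp add: cinner_self)

lemma norm_add_sq:
  "(norm (x + y))\<^sup>2 = (norm x)\<^sup>2 + (norm y)\<^sup>2 + 2 * Re (cinner x (y::'a::complex_hilbert))"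
proof -
  have "complex_of_real ((norm (x + y))\<^sup>2) = cinner x x + cinner y y + (cinner x y + cnj (cinner x y))"
    by (simp add: cinner_self[symmetric] cinner_add_left cinner_add_right
        del: of_real_power flip: cinner_commute)
  also have "\<dots> = complex_of_real ((norm x)\<^sup>2 + (norm y)\<^sup>2 + 2 * Re (cinner x y))"
    by (simp add: cinner_self complex_add_cnj)
  finally show ?thesis by (simp only: of_real_eq_iff)
qed

lemma norm_scaleC: "norm (c *\<^sub>C x) = cmod c * norm (x::'a::complex_hilbert)"
proof -
  have "complex_of_real ((norm (c *\<^sub>C x))\<^sup>2) = c * cnj c * cinner x x"
    by (simp add: cinner_self[symmetric] cinner_scaleC_left cinner_scaleC_right del: of_real_power)
  also have "\<dots> = complex_of_real ((cmod c * norm x)\<^sup>2)"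
    by (simp add: cinner_self complex_norm_square[symmetric] power_mult_distrib del: of_real_power)
  finally have "(norm (c *\<^sub>C x))\<^sup>2 = (cmod c * norm x)\<^sup>2" by (simp only: of_real_eq_iff)
  then show ?thesis by (simp add: power2_eq_iff_nonneg)
qed

lemma parallelogram:
  "(norm (x + y))\<^sup>2 + (norm (x - y))\<^sup>2 = 2 * (norm x)\<^sup>2 + 2 * (norm (y::'a::complex_hilbert))\<^sup>2"
  using norm_add_sq[of x y] norm_add_sq[of x "- y"] by (simp add: cinner_minus_right)

lemma cinner_Cauchy_Schwarz: "cmod (cinner x y) \<le> norm x * norm (y::'a::complex_hilbert)"
proof (cases "y = 0")
  case False
  define a where "a = cinner x y"
  define n where "n = (norm y)\<^sup>2"
  have n: "n > 0" using False by (simp add: n_def)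
  \<comment> \<open>The vector below is \<open>n\<close> times the component of \<open>x\<close> orthogonal to \<open>y\<close>.\<close>
  have "0 \<le> (norm (complex_of_real n *\<^sub>C x + (- a) *\<^sub>C y))\<^sup>2" by simp
  also have "\<dots> = n\<^sup>2 * (norm x)\<^sup>2 + (cmod a)\<^sup>2 * n + 2 * Re (complex_of_real n * (cnj (- a) * a))"
    by (subst norm_add_sq)
      (simp add: norm_scaleC cinner_scaleC_left cinner_scaleC_right power_mult_distrib
        mult.left_commute flip: n_def a_def)
  also have "Re (complex_of_real n * (cnj (- a) * a)) = - n * (cmod a)\<^sup>2"
    by (simp add: cmod_power2) (simp add: power2_eq_square)
  finally have "0 \<le> n * (n * (norm x)\<^sup>2 - (cmod a)\<^sup>2)"
    by (simp add: algebra_simps power2_eq_square)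
  then have "(cmod a)\<^sup>2 \<le> (norm x * norm y)\<^sup>2"
    using n by (simp add: zero_le_mult_iff n_def power_mult_distrib mult.commute)
  then show ?thesis unfolding a_def by (rule power2_le_imp_le) simp
qed simp

section \<open>Closed subspaces, representation of functionals, projections\<close>

lemma closed_csubspace_UNIV [simp]: "closed_csubspace (UNIV::'a::complex_hilbert set)"
  by (simp add: closed_csubspace_def)

lemma
  assumes "closed_csubspace M"
  shows csubspace_zero: "0 \<in> M"
    and csubspace_add: "x \<in> M \<Longrightarrow> y \<in> M \<Longrightarrow> x + y \<in> M"
    and csubspace_scaleC: "x \<in> M \<Longrightarrow> c *\<^sub>C x \<in> M"
  using assms by (auto simp: closed_csubspace_def)

lemma csubspace_diff: "closed_csubspace M \<Longrightarrow> x \<in> M \<Longrightarrow> y \<in> M \<Longrightarrow> x - y \<in> M"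
  using csubspace_add[of M x "- y"] csubspace_scaleC[of M y "- 1"] by (simp add: scaleC_minus_one)

lemma csubspace_eqI:
  assumes "closed_csubspace M" "a \<in> M" "b \<in> M" "\<And>f. f \<in> M \<Longrightarrow> cinner f a = cinner f b"
  shows "a = b"
proof -
  have "cinner (a - b) (a - b) = 0"
    using assms(4)[OF csubspace_diff[OF assms(1-3)]] by (simp add: cinner_diff_right)
  then show ?thesis by (simp add: cinner_self_eq_zero)
qed

text \<open>The representing vector is the minimiser of \<open>m \<mapsto> norm m ^ 2 - 2 * Re (\<phi> m)\<close>: by the
  parallelogram law every minimising sequence is Cauchy, and the first-order condition at the
  minimum is the asserted identity. Working on a closed subspace rather than the whole space
  makes this one result yield both orthogonal projections and adjoints.\<close>

theorem Riesz_representation: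
  fixes M :: "'a::complex_hilbert set" and \<phi> :: "'a \<Rightarrow> complex"
  assumes M: "closed_csubspace M"
    and add: "\<And>x y. x \<in> M \<Longrightarrow> y \<in> M \<Longrightarrow> \<phi> (x + y) = \<phi> x + \<phi> y"
    and scale: "\<And>c x. x \<in> M \<Longrightarrow> \<phi> (c *\<^sub>C x) = c * \<phi> x"
    and bound: "\<And>x. x \<in> M \<Longrightarrow> cmod (\<phi> x) \<le> K * norm x"
  obtains h where "h \<in> M" "\<And>m. m \<in> M \<Longrightarrow> \<phi> m = cinner m h"
proof -
  define J where "J m = (norm m)\<^sup>2 - 2 * Re (\<phi> m)" for m
  have diff: "\<phi> (x - y) = \<phi> x - \<phi> y" if "x \<in> M" "y \<in> M" for x y
    using add[of "x - y" y] csubspace_diff[OF M] that by simp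
  have "- (K\<^sup>2) \<le> J m" if "m \<in> M" for m
  proof -
    have "Re (\<phi> m) \<le> K * norm m"
      using bound[OF that] complex_Re_le_cmod order_trans by blast
    moreover have "0 \<le> (norm m - K)\<^sup>2" by simp
    ultimately show ?thesis by (simp add: J_def power2_eq_square algebra_simps)
  qed
  then have bdd: "bdd_below (J ` M)" by (auto intro!: bdd_belowI2)
  define d where "d = (INF m\<in>M. J m)"
  have d_le: "d \<le> J m" if "m \<in> M" for m
    unfolding d_def using bdd that by (rule cINF_lower)
  have "\<exists>m\<in>M. J m < d + 1 / real (Suc n)" for n
  proof -
    have "(INF m\<in>M. J m) < d + 1 / real (Suc n)" unfolding d_def by simp
    then show ?thesis using csubspace_zero[OF M] bdd by (subst (asm) cINF_less_iff) auto
  qed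
  then obtain s where s: "\<And>n. s n \<in> M" "\<And>n. J (s n) < d + 1 / real (Suc n)" by metis
  \<comment> \<open>Near-minimisers are close together because their midpoint cannot beat the infimum.\<close>
  have gap: "(norm (a - b))\<^sup>2 \<le> 2 * (J a - d) + 2 * (J b - d)" if ab: "a \<in> M" "b \<in> M" for a b
  proof -
    define c where "c = (1/2) *\<^sub>C (a + b)"
    have "c \<in> M" unfolding c_def by (intro csubspace_scaleC csubspace_add M ab)
    then have "d \<le> J c" by (rule d_le)
    moreover have "\<phi> c = (\<phi> a + \<phi> b) / 2"
      unfolding c_def using scale[of "a + b" "1/2"] add csubspace_add[OF M] ab by simp
    moreover have "norm c = norm (a + b) / 2" unfolding c_def by (simp add: norm_scaleC)
    ultimately have "4 * d \<le> (norm (a + b))\<^sup>2 - 4 * Re (\<phi> a) - 4 * Re (\<phi> b)"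
      by (simp add: J_def power_divide field_simps)
    then show ?thesis using parallelogram[of a b] by (simp add: J_def)
  qed
  have "Cauchy s"
  proof (rule metric_CauchyI)
    fix e :: real assume e: "e > 0"
    then have "0 < e\<^sup>2 / 4" by simp
    then obtain N where N: "inverse (real (Suc N)) < e\<^sup>2 / 4" using reals_Archimedean by blast
    have le: "J (s n) - d < e\<^sup>2 / 4" if "n \<ge> N" for n
    proof -
      have "1 / real (Suc n) \<le> inverse (real (Suc N))" using that by (simp add: field_simps)
      with s(2)[of n] N show ?thesis by linarith
    qed
    show "\<exists>N. \<forall>m\<ge>N. \<forall>n\<ge>N. dist (s m) (s n) < e"
    proof (intro exI allI impI)
      fix m n assume mn: "m \<ge> N" "n \<ge> N"
      have "(norm (s m - s n))\<^sup>2 \<le> 2 * (J (s m) - d) + 2 * (J (s n) - d)" by (rule gap[OF s(1) s(1)])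
      also have "\<dots> < 2 * (e\<^sup>2 / 4) + 2 * (e\<^sup>2 / 4)"
        by (intro add_strict_mono mult_strict_left_mono le mn) simp_all
      also have "\<dots> = e\<^sup>2" by simp
      finally have "(norm (s m - s n))\<^sup>2 < e\<^sup>2" .
      then have "norm (s m - s n) < e" by (rule power2_less_imp_less) (use e in simp)
      then show "dist (s m) (s n) < e" by (simp add: dist_norm)
    qed
  qed
  then obtain h where h: "s \<longlonglongrightarrow> h" using Cauchy_convergent_iff convergent_def by blast
  have hM: "h \<in> M"
    using M s(1) h closed_sequentially unfolding closed_csubspace_def by blast
  have "(\<lambda>n. \<phi> (s n)) \<longlonglongrightarrow> \<phi> h"
  proof (rule Lim_transform_bound[where g = "\<lambda>n. K * norm (s n - h)", THEN LIM_zero_cancel])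
    show "eventually (\<lambda>n. cmod (\<phi> (s n) - \<phi> h) \<le> norm (K * norm (s n - h))) sequentially"
    proof (intro always_eventually allI)
      fix n
      have "cmod (\<phi> (s n - h)) \<le> K * norm (s n - h)"
        by (intro bound csubspace_diff M s hM)
      then show "cmod (\<phi> (s n) - \<phi> h) \<le> norm (K * norm (s n - h))"
        using diff[OF s(1) hM] by simp
    qed
    have "(\<lambda>n. K * norm (s n - h)) \<longlonglongrightarrow> K * norm (h - h)" by (intro tendsto_intros h)
    then show "(\<lambda>n. K * norm (s n - h)) \<longlonglongrightarrow> 0" by simp
  qed
  then have "(\<lambda>n. J (s n)) \<longlonglongrightarrow> J h" unfolding J_def by (intro tendsto_intros h)
  moreover have "(\<lambda>n. d + 1 / real (Suc n)) \<longlonglongrightarrow> d + 0"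
    by (intro tendsto_intros LIMSEQ_Suc[OF lim_1_over_n])
  ultimately have Jh: "J h \<le> d"
    using s(2) by (intro LIMSEQ_le) (auto intro!: exI[of _ 0] less_imp_le)
  have Re_eq: "Re (\<phi> m) = Re (cinner h m)" if m: "m \<in> M" for m
  proof -
    define b where "b = Re (cinner h m) - Re (\<phi> m)"
    have quad: "0 \<le> t\<^sup>2 * (norm m)\<^sup>2 + 2 * t * b" for t :: real
    proof -
      define v where "v = complex_of_real t *\<^sub>C m"
      have v: "v \<in> M" unfolding v_def by (intro csubspace_scaleC M m)
      have "\<phi> (h + v) = \<phi> h + t * \<phi> m" using add[OF hM v] scale[OF m] by (simp add: v_def)
      moreover have "cinner h v = t * cinner h m" by (simp add: v_def cinner_scaleC_right)
      moreover have "norm v = \<bar>t\<bar> * norm m" by (simp add: v_def norm_scaleC)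
      moreover have "J h \<le> J (h + v)" using Jh d_le[OF csubspace_add[OF M hM v]] by simp
      ultimately show ?thesis
        by (simp add: J_def norm_add_sq b_def power_mult_distrib algebra_simps)
    qed
    \<comment> \<open>A nonnegative quadratic without constant term has no linear term: for \<open>b \<noteq> 0\<close> a small
      step against the sign of \<open>b\<close> makes it negative.\<close>
    have "b = 0"
    proof (rule ccontr)
      assume b: "b \<noteq> 0"
      define n where "n = (norm m)\<^sup>2 + 1"
      have n: "n > 0" "(norm m)\<^sup>2 < n" unfolding n_def by (simp_all add: add_nonneg_pos)
      have "0 \<le> (b / n)\<^sup>2 * (norm m)\<^sup>2 - 2 * b\<^sup>2 / n"
        using quad[of "- b / n"] by (simp add: power2_eq_square)
      also have "\<dots> < (b / n)\<^sup>2 * n - 2 * b\<^sup>2 / n" using n b by simp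
      also have "\<dots> = - b\<^sup>2 / n" using n by (simp add: field_simps power2_eq_square)
      also have "\<dots> \<le> 0" using n by simp
      finally show False by simp
    qed
    then show ?thesis by (simp add: b_def)
  qed
  have "\<phi> m = cinner m h" if m: "m \<in> M" for m
  proof (rule complex_eqI)
    show "Re (\<phi> m) = Re (cinner m h)"
      using Re_eq[OF m] cinner_commute[of m h] by simp
    show "Im (\<phi> m) = Im (cinner m h)"
      using Re_eq[OF csubspace_scaleC[OF M m, of \<i>]] cinner_commute[of m h]
      by (simp add: scale[OF m] cinner_scaleC_right)
  qed
  with hM show thesis by (rule that)
qed

lemma closed_csubspace_ocompl [simp]: "closed_csubspace (ocompl M)"
proof -
  have "closed (ocompl M)" unfolding closed_sequential_limits
  proof (intro allI impI)
    fix s l assume sl: "(\<forall>n. s n \<in> ocompl M) \<and> s \<longlonglongrightarrow> l"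
    show "l \<in> ocompl M" unfolding ocompl_def
    proof (intro CollectI ballI)
      fix m assume m: "m \<in> M"
      have "cmod (cinner l m) \<le> norm (l - s n) * norm m" for n
        using cinner_Cauchy_Schwarz[of "l - s n" m] sl m
        by (simp add: cinner_diff_left ocompl_def)
      moreover have "(\<lambda>n. norm (l - s n) * norm m) \<longlonglongrightarrow> norm (l - l) * norm m"
        using sl by (intro tendsto_intros) auto
      ultimately have "cmod (cinner l m) \<le> norm (l - l) * norm m"
        by (intro LIMSEQ_le_const[of "\<lambda>n. norm (l - s n) * norm m"]) auto
      then show "cinner l m = 0" by simp
    qed
  qed
  then show ?thesis
    by (auto simp: closed_csubspace_def ocompl_def cinner_add_left cinner_scaleC_left)
qed

lemma ocompl_orthogonal:
  assumes "x \<in> ocompl M" "m \<in> M"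
  shows "cinner x m = 0" "cinner m x = 0"
  using assms cinner_commute[of m x] by (auto simp: ocompl_def)

lemma oproj_eqI:
  assumes M: "closed_csubspace M" and p: "p \<in> M" "x - p \<in> ocompl M"
  shows "oproj M x = p"
  unfolding oproj_def
proof (rule the_equality)
  fix q assume q: "q \<in> M \<and> x - q \<in> ocompl M"
  show "q = p"
  proof (rule csubspace_eqI[OF M])
    fix f assume "f \<in> M"
    then have "cinner f (x - q) = 0" "cinner f (x - p) = 0"
      using p q ocompl_orthogonal(2) by blast+
    then show "cinner f q = cinner f p" by (simp add: cinner_diff_right)
  qed (use p q in auto)
qed (use p in auto)

lemma
  assumes M: "closed_csubspace M"
  shows oproj_in: "oproj M x \<in> M" and oproj_diff: "x - oproj M x \<in> ocompl M"
proof -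
  obtain h where h: "h \<in> M" "\<And>m. m \<in> M \<Longrightarrow> cinner m x = cinner m h"
  proof (rule Riesz_representation[OF M, of "\<lambda>m. cinner m x" "norm x"])
    show "cmod (cinner m x) \<le> norm x * norm m" for m
      using cinner_Cauchy_Schwarz[of m x] by (simp add: mult.commute)
  qed (auto simp: cinner_add_left cinner_scaleC_left)
  have d: "x - h \<in> ocompl M"
    unfolding ocompl_def
  proof (intro CollectI ballI)
    fix m assume "m \<in> M"
    then have "cinner m (x - h) = 0" using h(2) by (simp add: cinner_diff_right)
    then show "cinner (x - h) m = 0" using cinner_commute[of "x - h" m] by simp
  qed
  have "oproj M x = h" by (rule oproj_eqI[OF M h(1) d])
  with h d show "oproj M x \<in> M" "x - oproj M x \<in> ocompl M" by simp_all
qed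

lemma oproj_ocompl:
  assumes M: "closed_csubspace M"
  shows "oproj (ocompl M) x = x - oproj M x"
proof (rule oproj_eqI)
  show "x - (x - oproj M x) \<in> ocompl (ocompl M)"
    using oproj_in[OF M, of x] ocompl_orthogonal(2) by (auto simp: ocompl_def)
qed (simp_all add: oproj_diff[OF M])

lemma oproj_add_oproj_ocompl: "closed_csubspace M \<Longrightarrow> oproj M x + oproj (ocompl M) x = x"
  by (simp add: oproj_ocompl)

lemma oproj_id: "closed_csubspace M \<Longrightarrow> x \<in> M \<Longrightarrow> oproj M x = x"
  by (rule oproj_eqI) (auto simp: ocompl_def)

lemma oproj_of_ocompl: "closed_csubspace M \<Longrightarrow> x \<in> ocompl M \<Longrightarrow> oproj M x = 0"
  by (rule oproj_eqI) (auto simp: csubspace_zero)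

lemma
  assumes M: "closed_csubspace M" and m: "m \<in> M"
  shows cinner_oproj_left: "cinner (oproj M x) m = cinner x m"
    and cinner_oproj_right: "cinner m (oproj M x) = cinner m x"
  using ocompl_orthogonal[OF oproj_diff[OF M, of x] m]
  by (simp_all add: cinner_diff_left cinner_diff_right)

section \<open>Bounded operators and their adjoints\<close>

lemma bounded_opsI:
  assumes "\<And>x. x \<in> M \<Longrightarrow> T x \<in> N"
    and "\<And>x y. x \<in> M \<Longrightarrow> y \<in> M \<Longrightarrow> T (x + y) = T x + T y"
    and "\<And>c x. x \<in> M \<Longrightarrow> T (c *\<^sub>C x) = c *\<^sub>C T x"
    and "\<And>x. x \<in> M \<Longrightarrow> norm (T x) \<le> K * norm x"
  shows "T \<in> bounded_ops M N"
  using assms unfolding bounded_ops_def by blast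

lemma
  assumes "T \<in> bounded_ops M N"
  shows bounded_ops_in: "x \<in> M \<Longrightarrow> T x \<in> N"
    and bounded_ops_add: "x \<in> M \<Longrightarrow> y \<in> M \<Longrightarrow> T (x + y) = T x + T y"
    and bounded_ops_scaleC: "x \<in> M \<Longrightarrow> T (c *\<^sub>C x) = c *\<^sub>C T x"
  using assms by (auto simp: bounded_ops_def)

lemma bounded_ops_bound:
  assumes "T \<in> bounded_ops M N"
  obtains K where "K \<ge> 0" "\<And>x. x \<in> M \<Longrightarrow> norm (T x) \<le> K * norm x"
proof -
  obtain K where K: "\<And>x. x \<in> M \<Longrightarrow> norm (T x) \<le> K * norm x"
    using assms unfolding bounded_ops_def by blast
  have "norm (T x) \<le> \<bar>K\<bar> * norm x" if "x \<in> M" for x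
    by (rule order_trans[OF K[OF that]]) (simp add: mult_right_mono)
  then show thesis using that[of "\<bar>K\<bar>"] by simp
qed

lemma bounded_ops_zero:
  assumes "T \<in> bounded_ops M N" "closed_csubspace M"
  shows "T 0 = 0"
  using bounded_ops_add[OF assms(1), of 0 0] csubspace_zero[OF assms(2)] by simp

lemma bounded_ops_subset: "T \<in> bounded_ops M N \<Longrightarrow> N \<subseteq> L \<Longrightarrow> T \<in> bounded_ops M L"
  by (auto simp: bounded_ops_def)

lemma bounded_ops_compose:
  assumes T: "T \<in> bounded_ops M N" and S: "S \<in> bounded_ops N L"
  shows "(\<lambda>x. S (T x)) \<in> bounded_ops M L"
proof -
  obtain K where K: "\<And>x. x \<in> M \<Longrightarrow> norm (T x) \<le> K * norm x" using bounded_ops_bound[OF T] by blast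
  obtain K' where K': "K' \<ge> 0" "\<And>x. x \<in> N \<Longrightarrow> norm (S x) \<le> K' * norm x"
    using bounded_ops_bound[OF S] by blast
  show ?thesis
  proof (rule bounded_opsI)
    fix x assume x: "x \<in> M"
    have "norm (S (T x)) \<le> K' * norm (T x)" by (intro K' bounded_ops_in[OF T] x)
    also have "\<dots> \<le> K' * (K * norm x)" by (intro mult_left_mono K K' x)
    finally show "norm (S (T x)) \<le> (K' * K) * norm x" by (simp add: mult.assoc)
  qed (simp_all add: bounded_ops_in[OF T] bounded_ops_in[OF S] bounded_ops_add[OF T]
      bounded_ops_add[OF S] bounded_ops_scaleC[OF T] bounded_ops_scaleC[OF S])
qed

lemma bounded_ops_plus:
  assumes N: "closed_csubspace N" and T: "T \<in> bounded_ops M N" and S: "S \<in> bounded_ops M N"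
  shows "(\<lambda>x. T x + S x) \<in> bounded_ops M N"
proof -
  obtain K where K: "\<And>x. x \<in> M \<Longrightarrow> norm (T x) \<le> K * norm x" using bounded_ops_bound[OF T] by blast
  obtain K' where K': "\<And>x. x \<in> M \<Longrightarrow> norm (S x) \<le> K' * norm x" using bounded_ops_bound[OF S] by blast
  show ?thesis
  proof (rule bounded_opsI)
    fix x assume x: "x \<in> M"
    show "norm (T x + S x) \<le> (K + K') * norm x"
      using norm_triangle_ineq[of "T x" "S x"] K[OF x] K'[OF x] by (simp add: distrib_right)
  qed (simp_all add: bounded_ops_in[OF T] bounded_ops_in[OF S] bounded_ops_add[OF T] csubspace_add[OF N]
      bounded_ops_add[OF S] bounded_ops_scaleC[OF T] bounded_ops_scaleC[OF S] scaleC_add_right)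
qed

lemma bounded_ops_scaleC_op: "(\<lambda>x. c *\<^sub>C x) \<in> bounded_ops (UNIV::'a::complex_hilbert set) UNIV"
  by (rule bounded_opsI[where K = "cmod c"])
    (simp_all add: scaleC_add_right scaleC_scaleC norm_scaleC mult.commute)

lemma oproj_bounded_ops:
  assumes M: "closed_csubspace M"
  shows "oproj M \<in> bounded_ops UNIV M"
proof (rule bounded_opsI)
  fix x y
  show "oproj M (x + y) = oproj M x + oproj M y"
  proof (rule oproj_eqI[OF M])
    have "x + y - (oproj M x + oproj M y) = (x - oproj M x) + (y - oproj M y)" by simp
    then show "x + y - (oproj M x + oproj M y) \<in> ocompl M"
      by (simp only: csubspace_add[OF closed_csubspace_ocompl] oproj_diff[OF M])
  qed (intro csubspace_add M oproj_in)
next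
  fix c x
  show "oproj M (c *\<^sub>C x) = c *\<^sub>C oproj M x"
  proof (rule oproj_eqI[OF M])
    have "c *\<^sub>C x - c *\<^sub>C oproj M x = c *\<^sub>C (x - oproj M x)"
      using scaleC_add_right[of c x "- oproj M x"] by simp
    then show "c *\<^sub>C x - c *\<^sub>C oproj M x \<in> ocompl M"
      by (simp only: csubspace_scaleC[OF closed_csubspace_ocompl] oproj_diff[OF M])
  qed (intro csubspace_scaleC M oproj_in)
next
  fix x
  have "(norm (oproj M x + (x - oproj M x)))\<^sup>2 = (norm (oproj M x))\<^sup>2 + (norm (x - oproj M x))\<^sup>2"
    using ocompl_orthogonal(2)[OF oproj_diff[OF M] oproj_in[OF M], of x x]
    by (subst norm_add_sq) simp
  then have "(norm (oproj M x))\<^sup>2 \<le> (norm x)\<^sup>2" by simp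
  then have "norm (oproj M x) \<le> norm x" by (rule power2_le_imp_le) simp
  then show "norm (oproj M x) \<le> 1 * norm x" by simp
qed (rule oproj_in[OF M])

lemma cadjoint_eqI:
  assumes M: "closed_csubspace M" and h: "h \<in> M" "\<And>f. f \<in> M \<Longrightarrow> cinner (T f) g = cinner f h"
  shows "cadjoint M T g = h"
  unfolding cadjoint_def
proof (rule the_equality)
  fix k assume k: "k \<in> M \<and> (\<forall>f\<in>M. cinner (T f) g = cinner f k)"
  then show "k = h" using h by (intro csubspace_eqI[OF M]) auto
qed (use h in blast)

lemma
  assumes M: "closed_csubspace M" and T: "T \<in> bounded_ops M N"
  shows cadjoint_in: "cadjoint M T g \<in> M"
    and cinner_cadjoint: "f \<in> M \<Longrightarrow> cinner (T f) g = cinner f (cadjoint M T g)"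
proof -
  obtain K where K: "K \<ge> 0" "\<And>x. x \<in> M \<Longrightarrow> norm (T x) \<le> K * norm x"
    using bounded_ops_bound[OF T] by blast
  have bound: "cmod (cinner (T x) g) \<le> (K * norm g) * norm x" if "x \<in> M" for x
  proof -
    have "norm (T x) * norm g \<le> (K * norm x) * norm g"
      by (intro mult_right_mono K that) simp
    then show ?thesis using cinner_Cauchy_Schwarz[of "T x" g] by (simp add: mult_ac)
  qed
  obtain h where h: "h \<in> M" "\<And>m. m \<in> M \<Longrightarrow> cinner (T m) g = cinner m h"
    by (rule Riesz_representation[OF M, of "\<lambda>x. cinner (T x) g" "K * norm g"])
      (auto simp: bounded_ops_add[OF T] bounded_ops_scaleC[OF T] cinner_add_left
        cinner_scaleC_left bound)
  have "cadjoint M T g = h" by (rule cadjoint_eqI[OF M h])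
  with h show "cadjoint M T g \<in> M" "f \<in> M \<Longrightarrow> cinner (T f) g = cinner f (cadjoint M T g)"
    by simp_all
qed

lemma cadjoint_bounded_ops:
  assumes M: "closed_csubspace M" and T: "T \<in> bounded_ops M N"
  shows "cadjoint M T \<in> bounded_ops UNIV M"
proof -
  note [simp] = cinner_cadjoint[OF M T]
  obtain K where K: "K \<ge> 0" "\<And>x. x \<in> M \<Longrightarrow> norm (T x) \<le> K * norm x"
    using bounded_ops_bound[OF T] by blast
  show ?thesis
  proof (rule bounded_opsI)
    fix x y show "cadjoint M T (x + y) = cadjoint M T x + cadjoint M T y"
      by (rule cadjoint_eqI[OF M])
        (simp_all add: csubspace_add[OF M] cadjoint_in[OF M T] cinner_add_right)
  next
    fix c x show "cadjoint M T (c *\<^sub>C x) = c *\<^sub>C cadjoint M T x"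
      by (rule cadjoint_eqI[OF M])
        (simp_all add: csubspace_scaleC[OF M] cadjoint_in[OF M T] cinner_scaleC_right)
  next
    fix g
    \<comment> \<open>Pairing \<open>h\<close> with itself gives \<open>norm h ^ 2 = cinner (T h) g\<close>; then cancel one factor \<open>norm h\<close>.\<close>
    define h where "h = cadjoint M T g"
    have h: "h \<in> M" unfolding h_def by (rule cadjoint_in[OF M T])
    have "complex_of_real ((norm h)\<^sup>2) = cinner (T h) g"
      using h by (simp add: cinner_self[symmetric] h_def del: of_real_power)
    then have "(norm h)\<^sup>2 = cmod (cinner (T h) g)"
      by (metis norm_of_real abs_of_nonneg zero_le_power2)
    also have "\<dots> \<le> norm (T h) * norm g" by (rule cinner_Cauchy_Schwarz)
    also have "\<dots> \<le> (K * norm h) * norm g" by (intro mult_right_mono K h) simp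
    finally have "norm h * norm h \<le> norm h * (K * norm g)" by (simp add: power2_eq_square mult_ac)
    then have "norm h \<le> K * norm g"
      using K(1) by (cases "h = 0") auto
    then show "norm (cadjoint M T g) \<le> K * norm g" by (simp add: h_def)
  qed (rule cadjoint_in[OF M T])
qed

section \<open>Conjugations\<close>

lemma
  assumes "conjugation C"
  shows conj_add: "C (x + y) = C x + C y"
    and conj_scaleC: "C (c *\<^sub>C x) = cnj c *\<^sub>C C x"
    and conj_norm: "norm (C x) = norm x"
    and conj_conj: "C (C x) = x"
  using assms by (auto simp: conjugation_def)

lemma conj_zero: "conjugation C \<Longrightarrow> C 0 = 0"
  using conj_add[of C 0 0] by simp

lemma conj_diff: "conjugation C \<Longrightarrow> C (x - y) = C x - C y"
  using conj_add[of C "x - y" y] by simp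

text \<open>Polarisation recovers the real part of \<open>cinner\<close> from norms, which \<open>C\<close> preserves, and
  replacing \<open>y\<close> by \<open>\<i> *\<^sub>C y\<close> turns the imaginary part into a real part, where antilinearity
  produces a change of sign. So \<open>C\<close> conjugates inner products, and with \<open>C\<^sup>2 = I\<close> it can be
  moved from one argument to the other.\<close>

lemma cinner_conj_swap:
  assumes C: "conjugation C"
  shows "cinner (C x) y = cinner (C y) x"
proof -
  have Re: "Re (cinner (C u) (C v)) = Re (cinner u v)" for u v
    using norm_add_sq[of "C u" "C v"] norm_add_sq[of u v] conj_norm[OF C]
    by (simp flip: conj_add[OF C])
  have Im: "Im (cinner (C u) (C v)) = - Im (cinner u v)" for u v
    using Re[of u "\<i> *\<^sub>C v"] by (simp add: conj_scaleC[OF C] cinner_scaleC_right)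
  have "cinner (C x) (C (C y)) = cnj (cinner x (C y))"
    by (rule complex_eqI) (simp_all only: Re Im cnj.sel)
  then show ?thesis by (simp add: conj_conj[OF C] cinner_commute[of "C y" x])
qed

lemma conj_image_iff: "conjugation C \<Longrightarrow> x \<in> C ` M \<longleftrightarrow> C x \<in> M"
  by (metis conj_conj image_iff)

lemma closed_csubspace_conj:
  assumes C: "conjugation C" and M: "closed_csubspace M"
  shows "closed_csubspace (C ` M)"
proof -
  have "C ` M = C -` M" using conj_image_iff[OF C] by blast
  moreover have "continuous_on UNIV C"
    by (auto simp: continuous_on_iff dist_norm conj_norm[OF C] simp flip: conj_diff[OF C])
  ultimately have "closed (C ` M)"
    using M by (simp add: closed_csubspace_def closed_vimage)
  then show ?thesis
    by (simp add: closed_csubspace_def conj_image_iff[OF C] conj_zero[OF C] conj_add[OF C]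
        conj_scaleC[OF C] csubspace_zero[OF M] csubspace_add[OF M] csubspace_scaleC[OF M])
qed

lemma conj_ocompl:
  assumes C: "conjugation C"
  shows "C ` ocompl M = ocompl (C ` M)"
proof (rule set_eqI)
  fix x
  have "x \<in> ocompl (C ` M) \<longleftrightarrow> (\<forall>m\<in>M. cinner (C m) x = 0)"
    by (auto simp: ocompl_def cinner_commute[of x])
  then show "x \<in> C ` ocompl M \<longleftrightarrow> x \<in> ocompl (C ` M)"
    by (simp add: conj_image_iff[OF C] cinner_conj_swap[OF C, of _ x])
      (simp add: ocompl_def)
qed

lemma oproj_conj:
  assumes C: "conjugation C" and M: "closed_csubspace M"
  shows "oproj (C ` M) (C x) = C (oproj M x)"
proof (rule oproj_eqI[OF closed_csubspace_conj[OF C M]])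
  show "C x - C (oproj M x) \<in> ocompl (C ` M)"
    using oproj_diff[OF M, of x] by (simp flip: conj_ocompl[OF C] conj_diff[OF C])
qed (simp add: oproj_in[OF M])

lemma bounded_ops_conj:
  assumes C: "conjugation C" and T: "T \<in> bounded_ops M N"
  shows "(\<lambda>x. C (T (C x))) \<in> bounded_ops (C ` M) (C ` N)"
proof -
  obtain K where K: "\<And>x. x \<in> M \<Longrightarrow> norm (T x) \<le> K * norm x" using bounded_ops_bound[OF T] by blast
  show ?thesis
  proof (rule bounded_opsI[where K = K])
    fix x assume "x \<in> C ` M"
    then show "norm (C (T (C x))) \<le> K * norm x"
      using K[of "C x"] by (simp add: conj_image_iff[OF C] conj_norm[OF C])
  qed (auto simp: conj_conj[OF C] conj_add[OF C] conj_scaleC[OF C] bounded_ops_in[OF T]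
      bounded_ops_add[OF T] bounded_ops_scaleC[OF T])
qed

lemma bounded_ops_conj_UNIV:
  assumes C: "conjugation C" and T: "T \<in> bounded_ops UNIV N"
  shows "(\<lambda>x. C (T (C x))) \<in> bounded_ops UNIV UNIV"
proof -
  have "C ` UNIV = UNIV" by (auto simp: conj_image_iff[OF C])
  then show ?thesis using bounded_ops_subset[OF bounded_ops_conj[OF C T]] by auto
qed

text \<open>Both \<open>B \<mapsto> B\<^sup>*\<close> and \<open>B \<mapsto> C B C\<close> are additive involutions and they commute, so
  averaging \<open>W\<close> with \<open>C W\<^sup>* C\<close> gives a fixed point of \<open>B \<mapsto> C B\<^sup>* C\<close>.\<close>

lemma c_selfadjoint_average:
  assumes C: "conjugation C" and W: "W \<in> bounded_ops UNIV UNIV"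
  shows "c_selfadjoint C (\<lambda>x. (1/2) *\<^sub>C (W x + C (cadjoint UNIV W (C x))))"
    (is "c_selfadjoint C ?B")
  unfolding c_selfadjoint_def
proof (intro conjI allI)
  note U = closed_csubspace_UNIV
  show "?B \<in> bounded_ops UNIV UNIV"
    by (intro bounded_ops_compose[OF bounded_ops_plus[OF U W] bounded_ops_scaleC_op]
        bounded_ops_conj_UNIV[OF C cadjoint_bounded_ops[OF U W]])
  fix x
  have "cadjoint UNIV ?B g = (1/2) *\<^sub>C (cadjoint UNIV W g + C (W (C g)))" for g
  proof (rule cadjoint_eqI[OF U UNIV_I])
    fix f
    have "cinner (C (cadjoint UNIV W (C f))) g = cinner (W (C g)) (C f)"
      using cinner_conj_swap[OF C] cinner_cadjoint[OF U W, of "C g" "C f"] by simp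
    also have "\<dots> = cinner f (C (W (C g)))"
      using cinner_conj_swap[OF C, of f "W (C g)"] by (metis cinner_commute)
    finally show "cinner (?B f) g = cinner f ((1/2) *\<^sub>C (cadjoint UNIV W g + C (W (C g))))"
      using cinner_cadjoint[OF U W, of f g]
      by (simp add: cinner_add_left cinner_add_right cinner_scaleC_left cinner_scaleC_right)
  qed
  then show "?B x = C (cadjoint UNIV ?B (C x))"
    by (simp add: conj_scaleC[OF C] conj_add[OF C] conj_conj[OF C] add.commute)
qed

section \<open>Extensions of a C-symmetric operator\<close>

lemma V_ext_bounded_ops:
  assumes M: "closed_csubspace M" and V: "V \<in> bounded_ops M UNIV"
    and Z: "Z \<in> bounded_ops UNIV (ocompl M)"
  shows "V_ext M V Z \<in> bounded_ops UNIV UNIV"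
proof -
  have "(\<lambda>x. cadjoint UNIV Z (oproj (ocompl M) x)) \<in> bounded_ops UNIV UNIV"
    by (rule bounded_ops_compose[OF _ cadjoint_bounded_ops[OF closed_csubspace_UNIV Z]])
      (rule bounded_ops_subset[OF oproj_bounded_ops], auto)
  then show ?thesis
    using bounded_ops_plus[OF closed_csubspace_UNIV bounded_ops_compose[OF oproj_bounded_ops[OF M] V]]
    unfolding V_ext_def[abs_def] by blast
qed

text \<open>The projections drop out because \<open>V\<^sup>* g\<close> lies in \<open>M\<close> and \<open>Z g\<close> in its complement. This is
  why \<open>Z\<^sup>*\<close>, rather than \<open>Z\<close>, is used to extend \<open>V\<close>: the adjoint of the extension is then a
  sum whose two terms take values in complementary subspaces.\<close>

lemma cadjoint_V_ext:
  assumes M: "closed_csubspace M" and V: "V \<in> bounded_ops M UNIV"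
    and Z: "Z \<in> bounded_ops UNIV (ocompl M)"
  shows "cadjoint UNIV (V_ext M V Z) g = cadjoint M V g + Z g"
proof (rule cadjoint_eqI[OF closed_csubspace_UNIV UNIV_I])
  fix f
  have "cinner (V (oproj M f)) g = cinner f (cadjoint M V g)"
    by (rule trans[OF cinner_cadjoint[OF M V oproj_in[OF M]] cinner_oproj_left[OF M cadjoint_in[OF M V]]])
  moreover have "cinner (cadjoint UNIV Z q) g = cinner q (Z g)" for q
    using cinner_cadjoint[OF closed_csubspace_UNIV Z UNIV_I, of g q] by (metis cinner_commute)
  moreover have "cinner (oproj (ocompl M) f) (Z g) = cinner f (Z g)"
    by (rule cinner_oproj_left[OF closed_csubspace_ocompl bounded_ops_in[OF Z UNIV_I]])
  ultimately show "cinner (V_ext M V Z f) g = cinner f (cadjoint M V g + Z g)"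
    by (simp add: V_ext_def cinner_add_left cinner_add_right)
qed

lemma T_ext_eq:
  assumes M: "closed_csubspace M" and V: "V \<in> bounded_ops M UNIV"
    and Z: "Z \<in> bounded_ops UNIV (ocompl M)"
  shows "T_ext C M V Z x = (1/2) *\<^sub>C (V (oproj M x) + cadjoint UNIV Z (oproj (ocompl M) x)
    + C (cadjoint M V (C x) + Z (C x)))"
  unfolding T_ext_def cadjoint_V_ext[OF M V Z] by (simp add: V_ext_def)

text \<open>\<open>C\<close>-symmetry of \<open>V\<close> says that \<open>V\<^sup>* C h\<close> and \<open>C V h\<close> have the same inner products
  with \<open>M\<close>.\<close>

lemma cadjoint_c_symmetric:
  assumes M: "closed_csubspace M" and sym: "c_symmetric_on C M V" and h: "h \<in> M"
  shows "cadjoint M V (C h) = oproj M (C (V h))"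
proof (rule cadjoint_eqI[OF M oproj_in[OF M]])
  fix f assume "f \<in> M"
  then show "cinner (V f) (C h) = cinner f (oproj M (C (V h)))"
    using sym h by (simp add: c_symmetric_on_def cinner_oproj_right[OF M])
qed

section \<open>The parametrisation of the C-self-adjoint extensions\<close>

theorem theorem2p6:
  fixes C V Z0 :: "'a::complex_hilbert \<Rightarrow> 'a" and H\<^sub>V :: "'a set"
  assumes "conjugation C"
    and "closed_csubspace H\<^sub>V"
    and "V \<in> bounded_ops H\<^sub>V UNIV"
    and "c_symmetric_on C H\<^sub>V V"
    and "\<And>h. h \<in> H\<^sub>V \<Longrightarrow> Z0 (C h) = oproj (ocompl H\<^sub>V) (C (V h))"
  defines "Zt0 \<equiv> (\<lambda>x. Z0 (oproj (C ` H\<^sub>V) x))"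
  shows "Z0 \<in> bounded_ops (C ` H\<^sub>V) (ocompl H\<^sub>V)
    \<and> (\<forall>T. c_selfadjoint C T \<and> extends_on H\<^sub>V V T \<longrightarrow>
         (\<exists>Z \<in> bounded_ops UNIV (ocompl H\<^sub>V). extends_on (C ` H\<^sub>V) Z0 Z \<and> T = T_ext C H\<^sub>V V Z))
    \<and> (\<forall>Z \<in> bounded_ops UNIV (ocompl H\<^sub>V). extends_on (C ` H\<^sub>V) Z0 Z \<longrightarrow>
         c_selfadjoint C (T_ext C H\<^sub>V V Z) \<and> extends_on H\<^sub>V V (T_ext C H\<^sub>V V Z))
    \<and> (\<forall>x. V (oproj H\<^sub>V x) + C (cadjoint H\<^sub>V V (C (oproj (ocompl H\<^sub>V) x))) = T_ext C H\<^sub>V V Zt0 x)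
    \<and> (\<forall>x. T_ext C H\<^sub>V V Zt0 x
           = (1/2) *\<^sub>C (V_ext H\<^sub>V V Zt0 x + C (cadjoint UNIV (V_ext H\<^sub>V V Zt0) (C x))))
    \<and> (\<forall>Y \<in> bounded_ops (C ` (ocompl H\<^sub>V)) (ocompl H\<^sub>V). \<forall>Z.
         Z = (\<lambda>x. Z0 (oproj (C ` H\<^sub>V) x) + Y (oproj (C ` (ocompl H\<^sub>V)) x)) \<longrightarrow>
         (\<forall>x. T_ext C H\<^sub>V V Z x
            = T_ext C H\<^sub>V V Zt0 x
              + (1/2) *\<^sub>C (cadjoint (C ` (ocompl H\<^sub>V)) Y (oproj (ocompl H\<^sub>V) x)
                          + C (Y (C (oproj (ocompl H\<^sub>V) x))))))"
proof -
  note C = assms(1) and M = assms(2) and V = assms(3) and sym = assms(4)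
  note U = closed_csubspace_UNIV and O = closed_csubspace_ocompl
  let ?M = "H\<^sub>V" and ?N = "ocompl H\<^sub>V"
  note CM = closed_csubspace_conj[OF C M] and CN = closed_csubspace_conj[OF C O, of "?M"]
  note PN = bounded_ops_subset[OF oproj_bounded_ops subset_UNIV]
  have Z0_eq: "Z0 x = oproj ?N (C (V (C x)))" if "x \<in> C ` ?M" for x
    using assms(5)[of "C x"] that by (simp add: conj_image_iff[OF C] conj_conj[OF C])
  have "(\<lambda>x. oproj ?N (C (V (C x)))) \<in> bounded_ops (C ` ?M) ?N"
    by (rule bounded_ops_compose[OF bounded_ops_subset[OF bounded_ops_conj[OF C V] subset_UNIV]
          oproj_bounded_ops[OF O]])
  then have Z0: "Z0 \<in> bounded_ops (C ` ?M) ?N"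
    by (simp add: bounded_ops_def Z0_eq csubspace_add[OF CM] csubspace_scaleC[OF CM])
  have Zt0: "Zt0 \<in> bounded_ops UNIV ?N"
    unfolding Zt0_def by (rule bounded_ops_compose[OF oproj_bounded_ops[OF CM] Z0])
  have ext0: "extends_on (C ` ?M) Z0 Zt0"
    by (simp add: extends_on_def Zt0_def oproj_id[OF CM])

  have surj: "\<exists>Z \<in> bounded_ops UNIV ?N. extends_on (C ` ?M) Z0 Z \<and> T = T_ext C ?M V Z"
    if sa: "c_selfadjoint C T" and extT: "extends_on ?M V T" for T
  proof -
    have T: "T \<in> bounded_ops UNIV UNIV" and T_eq: "\<And>x. T x = C (cadjoint UNIV T (C x))"
      using sa by (auto simp: c_selfadjoint_def)
    \<comment> \<open>Chosen so that \<open>Z\<^sup>*\<close> agrees with \<open>T\<close> on the complement of the domain.\<close>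
    define Z where "Z x = oproj ?N (cadjoint UNIV T x)" for x
    have Tadj: "cadjoint UNIV T (C x) = C (T x)" for x
      using T_eq[of x] by (simp add: conj_conj[OF C])
    have Z: "Z \<in> bounded_ops UNIV ?N"
      unfolding Z_def[abs_def]
      by (rule bounded_ops_compose[OF cadjoint_bounded_ops[OF U T] oproj_bounded_ops[OF O]])
    have "extends_on (C ` ?M) Z0 Z"
      using extT by (auto simp: extends_on_def Z_def Tadj assms(5))
    moreover have "V_ext ?M V Z = T"
    proof
      fix x
      have "cadjoint UNIV Z (oproj ?N x) = T (oproj ?N x)"
      proof (rule cadjoint_eqI[OF U UNIV_I])
        fix f
        have "cinner (Z f) (oproj ?N x) = cinner (cadjoint UNIV T f) (oproj ?N x)"
          unfolding Z_def by (rule cinner_oproj_left[OF O oproj_in[OF O]])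
        also have "\<dots> = cinner f (T (oproj ?N x))"
          using cinner_cadjoint[OF U T UNIV_I, of "oproj ?N x" f] by (metis cinner_commute)
        finally show "cinner (Z f) (oproj ?N x) = cinner f (T (oproj ?N x))" .
      qed
      moreover have "V (oproj ?M x) = T (oproj ?M x)"
        using extT oproj_in[OF M] by (simp add: extends_on_def)
      ultimately show "V_ext ?M V Z x = T x"
        by (simp add: V_ext_def oproj_add_oproj_ocompl[OF M] flip: bounded_ops_add[OF T UNIV_I UNIV_I])
    qed
    then have "T = T_ext C ?M V Z"
      by (intro ext) (simp add: T_ext_def half_scaleC_double flip: T_eq)
    ultimately show ?thesis using Z by blast
  qed

  have conv: "c_selfadjoint C (T_ext C ?M V Z) \<and> extends_on ?M V (T_ext C ?M V Z)"
    if Z: "Z \<in> bounded_ops UNIV ?N" and ext: "extends_on (C ` ?M) Z0 Z" for Z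
  proof
    show "c_selfadjoint C (T_ext C ?M V Z)"
      unfolding T_ext_def[abs_def] by (rule c_selfadjoint_average[OF C V_ext_bounded_ops[OF M V Z]])
    show "extends_on ?M V (T_ext C ?M V Z)"
      unfolding extends_on_def
    proof
      fix h assume h: "h \<in> ?M"
      \<comment> \<open>The two summands are the complementary components of \<open>C (V h)\<close>.\<close>
      have "cadjoint ?M V (C h) + Z (C h) = C (V h)"
        using ext h
        by (simp add: extends_on_def cadjoint_c_symmetric[OF M sym] assms(5)
            oproj_add_oproj_ocompl[OF M])
      moreover have "oproj ?N h = 0" using h by (simp add: oproj_ocompl[OF M] oproj_id[OF M])
      ultimately show "T_ext C ?M V Z h = V h"
        using h by (simp add: T_ext_eq[OF M V Z] oproj_id[OF M] conj_conj[OF C]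
            half_scaleC_double bounded_ops_zero[OF cadjoint_bounded_ops[OF U Z] U])
    qed
  qed

  have canonical: "V (oproj ?M x) + C (cadjoint ?M V (C (oproj ?N x))) = T_ext C ?M V Zt0 x" for x
  proof -
    \<comment> \<open>On \<open>?p\<close> both sides are \<open>V ?p\<close>. On \<open>?q\<close> both terms being averaged equal
      \<open>C V\<^sup>* C ?q\<close>: one because \<open>Zt0\<^sup>*\<close> has this value, the other because \<open>Zt0\<close> vanishes at
      \<open>C ?q\<close>, which is orthogonal to the image of the domain under \<open>C\<close>.\<close>
    let ?q = "oproj ?N x" and ?p = "oproj ?M x"
    have q: "?q \<in> ?N" by (rule oproj_in[OF O])
    have T: "T_ext C ?M V Zt0 \<in> bounded_ops UNIV UNIV"
      using conv[OF Zt0 ext0] by (simp add: c_selfadjoint_def)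
    have "Zt0 (C ?q) = 0"
      by (simp add: Zt0_def oproj_conj[OF C M] oproj_of_ocompl[OF M q] conj_zero[OF C]
          bounded_ops_zero[OF Z0 CM])
    moreover have "cadjoint UNIV Zt0 ?q = C (cadjoint ?M V (C ?q))"
    proof (rule cadjoint_eqI[OF U UNIV_I])
      fix f
      let ?f = "oproj (C ` ?M) f"
      have f: "?f \<in> C ` ?M" "C ?f \<in> ?M"
        using oproj_in[OF CM, of f] by (simp_all add: conj_image_iff[OF C])
      have "cinner (Zt0 f) ?q = cinner (C (V (C ?f))) ?q"
        by (simp add: Zt0_def Z0_eq[OF f(1)] cinner_oproj_left[OF O q])
      also have "\<dots> = cnj (cinner (C (cadjoint ?M V (C ?q))) ?f)"
        using cinner_conj_swap[OF C] cinner_cadjoint[OF M V f(2), of "C ?q"]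
        by (metis cinner_commute)
      also have "\<dots> = cinner ?f (C (cadjoint ?M V (C ?q)))" by (simp flip: cinner_commute)
      also have "\<dots> = cinner f (C (cadjoint ?M V (C ?q)))"
        by (intro cinner_oproj_left[OF CM] imageI cadjoint_in[OF M V])
      finally show "cinner (Zt0 f) ?q = cinner f (C (cadjoint ?M V (C ?q)))" .
    qed
    ultimately have "T_ext C ?M V Zt0 ?q = C (cadjoint ?M V (C ?q))"
      by (simp add: T_ext_eq[OF M V Zt0] oproj_of_ocompl[OF M q] oproj_id[OF O q]
          bounded_ops_zero[OF V M] half_scaleC_double)
    moreover have "T_ext C ?M V Zt0 ?p = V ?p"
      using conv[OF Zt0 ext0] oproj_in[OF M] by (simp add: extends_on_def)
    moreover have "T_ext C ?M V Zt0 x = T_ext C ?M V Zt0 ?p + T_ext C ?M V Zt0 ?q"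
      by (simp add: oproj_add_oproj_ocompl[OF M] flip: bounded_ops_add[OF T UNIV_I UNIV_I])
    ultimately show ?thesis by simp
  qed

  \<comment> \<open>\<open>T_ext\<close> is additive in the parameter on top of the common contribution of \<open>V\<close>, so only the
    adjoint and the conjugate of the \<open>Y\<close> part have to be identified.\<close>
  have param: "T_ext C ?M V Z x = T_ext C ?M V Zt0 x
      + (1/2) *\<^sub>C (cadjoint (C ` ?N) Y (oproj ?N x) + C (Y (C (oproj ?N x))))"
    if Y: "Y \<in> bounded_ops (C ` ?N) ?N"
      and Z_def: "Z = (\<lambda>x. Z0 (oproj (C ` ?M) x) + Y (oproj (C ` ?N) x))" for Y Z x
  proof -
    have Yt: "(\<lambda>x. Y (oproj (C ` ?N) x)) \<in> bounded_ops UNIV ?N"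
      by (rule bounded_ops_compose[OF oproj_bounded_ops[OF CN] Y])
    have Z_eq: "Z = (\<lambda>x. Zt0 x + Y (oproj (C ` ?N) x))" by (simp add: Z_def Zt0_def)
    have Z: "Z \<in> bounded_ops UNIV ?N"
      unfolding Z_eq by (rule bounded_ops_plus[OF O Zt0 Yt])
    have "cadjoint UNIV Z q = cadjoint UNIV Zt0 q + cadjoint (C ` ?N) Y q" for q
    proof (rule cadjoint_eqI[OF U UNIV_I])
      fix f
      have "cinner (Y (oproj (C ` ?N) f)) q = cinner f (cadjoint (C ` ?N) Y q)"
        by (rule trans[OF cinner_cadjoint[OF CN Y oproj_in[OF CN]]
              cinner_oproj_left[OF CN cadjoint_in[OF CN Y]]])
      then show "cinner (Z f) q = cinner f (cadjoint UNIV Zt0 q + cadjoint (C ` ?N) Y q)"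
        using cinner_cadjoint[OF U Zt0 UNIV_I, of f q]
        by (simp add: Z_eq cinner_add_left cinner_add_right)
    qed
    moreover have "Z (C x) = Zt0 (C x) + Y (C (oproj ?N x))"
      by (simp add: Z_eq oproj_conj[OF C O])
    ultimately show ?thesis
      unfolding T_ext_eq[OF M V Z] T_ext_eq[OF M V Zt0]
      by (simp add: conj_add[OF C] scaleC_add_right)
  qed

  show ?thesis
  proof (intro conjI allI ballI impI)
    fix T assume "c_selfadjoint C T \<and> extends_on ?M V T"
    then show "\<exists>Z \<in> bounded_ops UNIV ?N. extends_on (C ` ?M) Z0 Z \<and> T = T_ext C ?M V Z"
      by (elim conjE) (rule surj)
  next
    fix Z assume "Z \<in> bounded_ops UNIV ?N" "extends_on (C ` ?M) Z0 Z"
    then show "c_selfadjoint C (T_ext C ?M V Z)" "extends_on ?M V (T_ext C ?M V Z)"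
      using conv by simp_all
  qed (rule Z0 canonical T_ext_def param; assumption)+
qed

end
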